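(* Let $\Gamma,\Sigma$ be finite alphabets. Any function $f:\mathrm{BinTree}(\Gamma)\to\mathrm{BinTree}(\Sigma)$ computed by a register tree transducer can be expressed in the simply typed $\lambda$-calculus by a closed term $t:\mathtt{BT}_\Gamma[A]\to\mathtt{BT}_\Sigma$ for some simple type $A$, i.e. $t\,\overline{T}=_\beta\overline{f(T)}$ for all $T\in\mathrm{BinTree}(\Gamma)$.
   Context: Trees: $\mathrm{BinTree}(\Sigma)$ is generated by $T,U::=\langle\rangle\mid a\langle T,U\rangle$ ($a\in\Sigma$); one-hole trees $\partial\mathrm{BinTree}(\Sigma)$ are generated by $T'::=\square\mid a\langle T',T\rangle\mid a\langle T,T'\rangle$; $T'[U]$ replaces $\square$ by $U$. Expressions over variable sets $V,V'$: $\mathrm{ExprBT}(\Sigma,V,V')$ is generated by $E,F::=\langle\rangle\mid x\mid a\langle E,F\rangle\mid E'[E]$ and $\mathrm{Expr}\partial\mathrm{BT}(\Sigma,V,V')$ by $E',F'::=\square\mid x'\mid a\langle E',E\rangle\mid a\langle E,E'\rangle\mid E'[F']$ ($x\in V$, $x'\in V'$, $a\in\Sigma$); given $\rho:V\to\mathrm{BinTree}(\Sigma)$ and $\rho':V'\to\partial\mathrm{BinTree}(\Sigma)$, $E(\rho,\rho')$ and $E'(\rho,\rho')$ are obtained by substituting values for variables and performing hole substitutions. A register tree transducer $\mathrm{BinTree}(\Gamma)\to\mathrm{BinTree}(\Sigma)$ consists of a finite set $Q$ of states with initial state $q_I$, disjoint finite sets $R,R'$ of registers, an output function $F:Q\to\mathrm{ExprBT}(\Sigma,R,R')$,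 and a transition function $\delta:Q\times Q\times\Gamma\to Q\times(R\to\mathrm{ExprBT}(\Sigma,R_{\triangleleft\triangleright},R'_{\triangleleft\triangleright}))\times(R'\to\mathrm{Expr}\partial\mathrm{BT}(\Sigma,R_{\triangleleft\triangleright},R'_{\triangleleft\triangleright}))$ where $R_{\triangleleft\triangleright}=R\times\{\triangleleft,\triangleright\}$, $R'_{\triangleleft\triangleright}=R'\times\{\triangleleft,\triangleright\}$. It assigns bottom-up to each subtree a configuration in $Q\times\mathrm{BinTree}(\Sigma)^R\times\partial\mathrm{BinTree}(\Sigma)^{R'}$: a leaf $\langle\rangle$ gets $(q_I,(r\mapsto\langle\rangle),(r'\mapsto\square))$; if $T$ and $U$ get $(q_\triangleleft,\rho_\triangleleft,\rho'_\triangleleft)$ and $(q_\triangleright,\rho_\triangleright,\rho'_\triangleright)$ and $\delta(q_\triangleleft,q_\triangleright,a)=(q,\psi,\psi')$, then $a\langle T,U\rangle$ gets $(q,(r\mapsto\psi(r)(\rho,\rho')),(r'\mapsto\psi'(r')(\rho,\rho')))$ where $\rho(r,z)=\rho_z(r)$ and $\rho'(r',z)=\rho'_z(r')$ for $z\in\{\triangleleft,\triangleright\}$. The output on a tree whose configuration is $(q,\rho,\rho')$ is $F(q)(\rho,\rho')$. Simply typed $\lambda$-calculus: simple types $A,B::=o\mid A\to B$ ($\to$ associates to the right, $A^n\to B$ means $n$ copies of $A$); terms $x\mid t\,u\mid\lambda x.\,t$ with the usual simple typing; $=_\beta$ generated by $(\lambda x.\,t)\,u=_\beta t\{x:=u\}$;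 $A[B]$ is $A$ with $o$ replaced by $B$. For $\Sigma=\{a_1,\dots,a_n\}$, $\mathtt{BT}_\Sigma=(o\to o\to o)^n\to o\to o$ and $T\in\mathrm{BinTree}(\Sigma)$ is encoded as $\overline{T}=\lambda f_1.\cdots\lambda f_n.\,\lambda x.\,\widehat{T}$ with $\widehat{\langle\rangle}=x$ and $\widehat{a_i\langle T,U\rangle}=f_i\,\widehat T\,\widehat U$. *)

theory Defs
  imports "HOL-Library.Tree"
begin

section \<open>Trees, one-hole trees and expressions\<close>

definition BinTree :: "'a set \<Rightarrow> 'a tree set" where
  "BinTree \<Sigma> = {T. set_tree T \<subseteq> \<Sigma>}"

text \<open>The grammar's \<open>a\<langle>T,U\<rangle>\<close> is the library's \<open>Node T a U\<close>.\<close>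

datatype 'a otree =
    Hole
  | ONodeL 'a "'a otree" "'a tree"
  | ONodeR 'a "'a tree" "'a otree"

primrec plug :: "'a otree \<Rightarrow> 'a tree \<Rightarrow> 'a tree" where
  "plug Hole U = U"
| "plug (ONodeL a T' T) U = Node (plug T' U) a T"
| "plug (ONodeR a T T') U = Node T a (plug T' U)"

primrec oplug :: "'a otree \<Rightarrow> 'a otree \<Rightarrow> 'a otree" where
  "oplug Hole U' = U'"
| "oplug (ONodeL a T' T) U' = ONodeL a (oplug T' U') T"
| "oplug (ONodeR a T T') U' = ONodeR a T (oplug T' U')"

datatype (expr_labels: 'a, expr_vars: 'v, expr_ovars: 'w) expr =
    ELeaf
  | EVar 'v
  | ENode 'a "('a, 'v, 'w) expr" "('a, 'v, 'w) expr"
  | EPlug "('a, 'v, 'w) oexpr" "('a, 'v, 'w) expr"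
and (oexpr_labels: 'a, oexpr_vars: 'v, oexpr_ovars: 'w) oexpr =
    OHole
  | OVar 'w
  | OENodeL 'a "('a, 'v, 'w) oexpr" "('a, 'v, 'w) expr"
  | OENodeR 'a "('a, 'v, 'w) expr" "('a, 'v, 'w) oexpr"
  | OPlug "('a, 'v, 'w) oexpr" "('a, 'v, 'w) oexpr"

definition ExprBT :: "'a set \<Rightarrow> 'v set \<Rightarrow> 'w set \<Rightarrow> ('a, 'v, 'w) expr set" where
  "ExprBT \<Sigma> V V' = {E. expr_labels E \<subseteq> \<Sigma> \<and> expr_vars E \<subseteq> V \<and> expr_ovars E \<subseteq> V'}"

definition ExprOBT :: "'a set \<Rightarrow> 'v set \<Rightarrow> 'w set \<Rightarrow> ('a, 'v, 'w) oexpr set" where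
  "ExprOBT \<Sigma> V V' = {E'. oexpr_labels E' \<subseteq> \<Sigma> \<and> oexpr_vars E' \<subseteq> V \<and> oexpr_ovars E' \<subseteq> V'}"

primrec eval_expr :: "('v \<Rightarrow> 'a tree) \<Rightarrow> ('w \<Rightarrow> 'a otree) \<Rightarrow> ('a, 'v, 'w) expr \<Rightarrow> 'a tree"
  and eval_oexpr :: "('v \<Rightarrow> 'a tree) \<Rightarrow> ('w \<Rightarrow> 'a otree) \<Rightarrow> ('a, 'v, 'w) oexpr \<Rightarrow> 'a otree" where
  "eval_expr \<rho> \<rho>' ELeaf = Leaf"
| "eval_expr \<rho> \<rho>' (EVar x) = \<rho> x"
| "eval_expr \<rho> \<rho>' (ENode a E F) = Node (eval_expr \<rho> \<rho>' E) a (eval_expr \<rho> \<rho>' F)"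
| "eval_expr \<rho> \<rho>' (EPlug E' E) = plug (eval_oexpr \<rho> \<rho>' E') (eval_expr \<rho> \<rho>' E)"
| "eval_oexpr \<rho> \<rho>' OHole = Hole"
| "eval_oexpr \<rho> \<rho>' (OVar x') = \<rho>' x'"
| "eval_oexpr \<rho> \<rho>' (OENodeL a E' E) = ONodeL a (eval_oexpr \<rho> \<rho>' E') (eval_expr \<rho> \<rho>' E)"
| "eval_oexpr \<rho> \<rho>' (OENodeR a E E') = ONodeR a (eval_expr \<rho> \<rho>' E) (eval_oexpr \<rho> \<rho>' E')"
| "eval_oexpr \<rho> \<rho>' (OPlug E' F') = oplug (eval_oexpr \<rho> \<rho>' E') (eval_oexpr \<rho> \<rho>' F')"


section \<open>Register tree transducers\<close>

datatype side = LeftChild | RightChild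

text \<open>The components are total HOL functions; only their values on the carrier sets
  (\<open>states\<close>, \<open>regs\<close>, \<open>oregs\<close> and the input alphabet) matter, and only those are
  constrained by \<open>rtt\<close> below.\<close>

record ('q, 'g, 's, 'r) rtt =
  states :: "'q set"
  init :: 'q
  regs :: "'r set"
  oregs :: "'r set"
  out :: "'q \<Rightarrow> ('s, 'r, 'r) expr"
  delta :: "'q \<times> 'q \<times> 'g \<Rightarrow>
    'q \<times> ('r \<Rightarrow> ('s, 'r \<times> side, 'r \<times> side) expr) \<times> ('r \<Rightarrow> ('s, 'r \<times> side, 'r \<times> side) oexpr)"

definition rtt :: "'g set \<Rightarrow> 's set \<Rightarrow> ('q, 'g, 's, 'r) rtt \<Rightarrow> bool" where
  "rtt \<Gamma> \<Sigma> M \<longleftrightarrow>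
    finite (states M) \<and> init M \<in> states M \<and>
    finite (regs M) \<and> finite (oregs M) \<and> regs M \<inter> oregs M = {} \<and>
    (\<forall>q\<in>states M. out M q \<in> ExprBT \<Sigma> (regs M) (oregs M)) \<and>
    (\<forall>q\<^sub>1\<in>states M. \<forall>q\<^sub>2\<in>states M. \<forall>a\<in>\<Gamma>. \<forall>q \<psi> \<psi>'. delta M (q\<^sub>1, q\<^sub>2, a) = (q, \<psi>, \<psi>') \<longrightarrow>
      q \<in> states M \<and>
      (\<forall>r\<in>regs M. \<psi> r \<in> ExprBT \<Sigma> (regs M \<times> UNIV) (oregs M \<times> UNIV)) \<and>
      (\<forall>r'\<in>oregs M. \<psi>' r' \<in> ExprOBT \<Sigma> (regs M \<times> UNIV) (oregs M \<times> UNIV)))"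

definition join :: "('r \<Rightarrow> 'b) \<Rightarrow> ('r \<Rightarrow> 'b) \<Rightarrow> 'r \<times> side \<Rightarrow> 'b" where
  "join \<rho>\<^sub>1 \<rho>\<^sub>2 = (\<lambda>(r, z). case z of LeftChild \<Rightarrow> \<rho>\<^sub>1 r | RightChild \<Rightarrow> \<rho>\<^sub>2 r)"

primrec config :: "('q, 'g, 's, 'r) rtt \<Rightarrow> 'g tree \<Rightarrow> 'q \<times> ('r \<Rightarrow> 's tree) \<times> ('r \<Rightarrow> 's otree)" where
  "config M Leaf = (init M, (\<lambda>r. Leaf), (\<lambda>r'. Hole))"
| "config M (Node T a U) =
    (let (q\<^sub>1, \<rho>\<^sub>1, \<rho>\<^sub>1') = config M T;
         (q\<^sub>2, \<rho>\<^sub>2, \<rho>\<^sub>2') = config M U;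
         (q, \<psi>, \<psi>') = delta M (q\<^sub>1, q\<^sub>2, a);
         \<rho> = join \<rho>\<^sub>1 \<rho>\<^sub>2;
         \<rho>' = join \<rho>\<^sub>1' \<rho>\<^sub>2'
     in (q, (\<lambda>r. eval_expr \<rho> \<rho>' (\<psi> r)), (\<lambda>r'. eval_oexpr \<rho> \<rho>' (\<psi>' r'))))"

definition rtt_output :: "('q, 'g, 's, 'r) rtt \<Rightarrow> 'g tree \<Rightarrow> 's tree" where
  "rtt_output M T = (case config M T of (q, \<rho>, \<rho>') \<Rightarrow> eval_expr \<rho> \<rho>' (out M q))"

definition computes :: "'g set \<Rightarrow> ('q, 'g, 's, 'r) rtt \<Rightarrow> ('g tree \<Rightarrow> 's tree) \<Rightarrow> bool" where
  "computes \<Gamma> M f \<longleftrightarrow> (\<forall>T\<in>BinTree \<Gamma>. f T = rtt_output M T)"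


section \<open>The simply typed lambda-calculus\<close>

text \<open>Terms are unannotated and in de Bruijn notation, i.e. taken up to renaming of bound
  variables; typing is Curry-style.\<close>

datatype ty = Base | Arrow ty ty  (infixr "\<rightharpoonup>" 70)

datatype tm = Var nat | App tm tm  (infixl "\<cdot>" 80) | Lam tm

primrec ty_subst :: "ty \<Rightarrow> ty \<Rightarrow> ty" where
  "ty_subst Base B = B"
| "ty_subst (A\<^sub>1 \<rightharpoonup> A\<^sub>2) B = ty_subst A\<^sub>1 B \<rightharpoonup> ty_subst A\<^sub>2 B"

primrec lift :: "nat \<Rightarrow> tm \<Rightarrow> tm" where
  "lift k (Var i) = Var (if i < k then i else Suc i)"
| "lift k (t \<cdot> u) = lift k t \<cdot> lift k u"
| "lift k (Lam t) = Lam (lift (Suc k) t)"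

text \<open>\<open>subst k s t\<close> replaces variable \<open>k\<close> of \<open>t\<close> by \<open>s\<close> and lowers the variables
  above \<open>k\<close>, since the binder of \<open>k\<close> disappears.\<close>

primrec subst :: "nat \<Rightarrow> tm \<Rightarrow> tm \<Rightarrow> tm" where
  "subst k s (Var i) = (if i < k then Var i else if i = k then s else Var (i - 1))"
| "subst k s (t \<cdot> u) = subst k s t \<cdot> subst k s u"
| "subst k s (Lam t) = Lam (subst (Suc k) (lift 0 s) t)"

inductive beta_eq :: "tm \<Rightarrow> tm \<Rightarrow> bool"  (infix "=\<^sub>\<beta>" 50) where
  beta: "Lam t \<cdot> u =\<^sub>\<beta> subst 0 u t"
| refl: "t =\<^sub>\<beta> t"
| sym: "t =\<^sub>\<beta> u \<Longrightarrow> u =\<^sub>\<beta> t"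
| trans: "t =\<^sub>\<beta> u \<Longrightarrow> u =\<^sub>\<beta> v \<Longrightarrow> t =\<^sub>\<beta> v"
| app: "t =\<^sub>\<beta> t' \<Longrightarrow> u =\<^sub>\<beta> u' \<Longrightarrow> t \<cdot> u =\<^sub>\<beta> t' \<cdot> u'"
| lam: "t =\<^sub>\<beta> t' \<Longrightarrow> Lam t =\<^sub>\<beta> Lam t'"

inductive typing :: "ty list \<Rightarrow> tm \<Rightarrow> ty \<Rightarrow> bool"  ("_ \<turnstile> _ \<Ztypecolon> _" [50, 50, 50] 50) where
  Var: "i < length \<Delta> \<Longrightarrow> \<Delta> \<turnstile> Var i \<Ztypecolon> \<Delta> ! i"
| App: "\<Delta> \<turnstile> t \<Ztypecolon> A \<rightharpoonup> B \<Longrightarrow> \<Delta> \<turnstile> u \<Ztypecolon> A \<Longrightarrow> \<Delta> \<turnstile> t \<cdot> u \<Ztypecolon> B"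
| Lam: "A # \<Delta> \<turnstile> t \<Ztypecolon> B \<Longrightarrow> \<Delta> \<turnstile> Lam t \<Ztypecolon> A \<rightharpoonup> B"


section \<open>Encoding of trees\<close>

text \<open>The encoding depends on an enumeration \<open>as = [a\<^sub>1, \<dots>, a\<^sub>n]\<close> of the alphabet,
  given as a distinct list.\<close>

definition BT :: "'a list \<Rightarrow> ty" where
  "BT as = (((\<rightharpoonup>) (Base \<rightharpoonup> Base \<rightharpoonup> Base)) ^^ length as) (Base \<rightharpoonup> Base)"

text \<open>Under the binders \<open>\<lambda>f\<^sub>1. \<dots> \<lambda>f\<^sub>n. \<lambda>x.\<close> the variable \<open>x\<close> has index \<open>0\<close> and
  \<open>f\<^sub>i\<close> has index \<open>n - (i - 1)\<close>; for \<open>a = a\<^sub>i\<close> the \<open>takeWhile\<close> below has length \<open>i - 1\<close>.\<close>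

primrec enc_body :: "'a list \<Rightarrow> 'a tree \<Rightarrow> tm" where
  "enc_body as Leaf = Var 0"
| "enc_body as (Node T a U) =
    Var (length as - length (takeWhile (\<lambda>b. b \<noteq> a) as)) \<cdot> enc_body as T \<cdot> enc_body as U"

definition enc :: "'a list \<Rightarrow> 'a tree \<Rightarrow> tm" where
  "enc as T = (Lam ^^ length as) (Lam (enc_body as T))"

end

theory Submission
  imports Defs
begin

text \<open>A configuration \<open>(q, \<rho>, \<rho>')\<close> is represented in continuation-passing style: with
  \<open>m\<close> states, it is a term of type \<open>K\<^sup>m \<rightarrow> o\<close> that calls its \<open>q\<close>-th argument on the register
  contents, where trees have type \<open>o\<close>, one-hole trees have type \<open>o \<rightarrow> o\<close>, and
  \<open>K = o\<^sup>k \<rightarrow> (o \<rightarrow> o)\<^sup>l \<rightarrow> o\<close> for \<open>k\<close> and \<open>l\<close> registers of the two kinds. The constructors of the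
  output tree remain free variables. A transition calls both children with one
  continuation for each state, so the next state is selected by the resulting pair of states,
  and iterating the encoded input tree over the transitions computes the configuration.\<close>

section \<open>Parallel substitution\<close>

text \<open>Terms are kept as a body together with an environment, so that a run of beta steps only
  extends the environment.\<close>

primrec psubst :: "(nat \<Rightarrow> tm) \<Rightarrow> tm \<Rightarrow> tm" where
  "psubst \<sigma> (Var i) = \<sigma> i"
| "psubst \<sigma> (t \<cdot> u) = psubst \<sigma> t \<cdot> psubst \<sigma> u"
| "psubst \<sigma> (Lam t) = Lam (psubst (case_nat (Var 0) (lift 0 \<circ> \<sigma>)) t)"

lemma lift_lift: "i \<le> k \<Longrightarrow> lift (Suc k) (lift i t) = lift i (lift k t)"
  by (induction t arbitrary: i k) auto

lemma lift_subst: "i \<le> k \<Longrightarrow> subst (Suc k) (lift i s) (lift i t) = lift i (subst k s t)"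
proof (induction t arbitrary: i k s)
  case (Lam t)
  have "lift 0 (lift i s) = lift (Suc i) (lift 0 s)"
    by (simp add: lift_lift)
  then show ?case
    using Lam.IH[of "Suc i" "Suc k" "lift 0 s"] Lam.prems by simp
qed auto

lemma subst_lift: "subst k s (lift k t) = t"
  by (induction t arbitrary: k s) auto

lemma psubst_Var: "psubst Var t = t"
proof (induction t)
  case (Lam t)
  have "case_nat (Var 0) (lift 0 \<circ> Var) = Var"
    by (auto simp: fun_eq_iff split: nat.split)
  with Lam show ?case by simp
qed auto

lemma subst_psubst: "subst k s (psubst \<sigma> t) = psubst (subst k s \<circ> \<sigma>) t"
proof (induction t arbitrary: k s \<sigma>)
  case (Lam t)
  have "subst (Suc k) (lift 0 s) \<circ> case_nat (Var 0) (lift 0 \<circ> \<sigma>)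
      = case_nat (Var 0) (lift 0 \<circ> (subst k s \<circ> \<sigma>))"
    by (auto simp: fun_eq_iff lift_subst split: nat.split)
  then show ?case by (simp only: subst.simps psubst.simps Lam.IH)
qed auto

declare beta_eq.trans [trans]

text \<open>Contracting the redex composes \<open>subst 0 u\<close> with the environment pushed
  under the binder. Variable \<open>0\<close> receives \<open>u\<close>, and on the other entries
  the substitution cancels the lift (\<open>subst_lift\<close>).\<close>

lemma beta_psubst: "psubst \<sigma> (Lam t) \<cdot> u =\<^sub>\<beta> psubst (case_nat u \<sigma>) t"
proof -
  have "subst 0 u \<circ> case_nat (Var 0) (lift 0 \<circ> \<sigma>) = case_nat u \<sigma>"
    by (auto simp: fun_eq_iff subst_lift split: nat.split)
  then show ?thesis
    using beta_eq.beta[of "psubst (case_nat (Var 0) (lift 0 \<circ> \<sigma>)) t" u]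
    by (simp add: subst_psubst)
qed

text \<open>Serves the abstractions that remain in the result, those over the constructors of the
  output tree. The environment below them is described by its values instead of by nested uses of
  \<open>case_nat\<close>.\<close>

lemma psubst_Lams:
  assumes "\<And>i. i < n \<Longrightarrow> \<sigma>' i = Var i" and "\<And>i. \<sigma>' (n + i) = (lift 0 ^^ n) (\<sigma> i)"
  shows "psubst \<sigma> ((Lam ^^ n) t) = (Lam ^^ n) (psubst \<sigma>' t)"
  using assms
proof (induction n arbitrary: \<sigma>)
  case 0
  then have "\<sigma>' = \<sigma>" by auto
  then show ?case by simp
next
  case (Suc n)
  let ?up = "case_nat (Var 0) (lift 0 \<circ> \<sigma>)"
  have lifts: "(lift 0 ^^ n) (Var 0) = Var n" for n
    by (induction n) auto
  \<comment> \<open>Index \<open>i = 0\<close> is the outermost bound variable; \<open>n\<close>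
    lifts turn its \<open>Var 0\<close> into \<open>Var n\<close>.\<close>
  have "\<sigma>' (n + i) = (lift 0 ^^ n) (?up i)" for i
  proof (cases i)
    case 0
    then show ?thesis using Suc.prems(1)[of n] lifts by simp
  next
    case (Suc j)
    then show ?thesis using Suc.prems(2)[of j] by (simp add: funpow_swap1)
  qed
  with Suc show ?case by simp
qed

lemma beta_eq_Lams: "t =\<^sub>\<beta> t' \<Longrightarrow> (Lam ^^ n) t =\<^sub>\<beta> (Lam ^^ n) t'"
  by (induction n) (auto intro: beta_eq.lam)

section \<open>Iterated application and abstraction\<close>

definition apps :: "tm \<Rightarrow> tm list \<Rightarrow> tm" where
  "apps = foldl (\<cdot>)"

lemma apps_simps [simp]: "apps t [] = t" "apps t (u # us) = apps (t \<cdot> u) us"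
  by (simp_all add: apps_def)

lemma psubst_apps [simp]: "psubst \<sigma> (apps t us) = apps (psubst \<sigma> t) (map (psubst \<sigma>) us)"
  by (induction us arbitrary: t) auto

lemma apps_cong: "t =\<^sub>\<beta> t' \<Longrightarrow> apps t us =\<^sub>\<beta> apps t' us"
  by (induction us arbitrary: t t') (auto intro: beta_eq.app beta_eq.refl)

section \<open>Environments for blocks of named binders\<close>

text \<open>The index of the variable named \<open>x\<close> right below abstractions over the names \<open>xs\<close>.\<close>

primrec idx :: "'a list \<Rightarrow> 'a \<Rightarrow> nat" where
  "idx [] x = 0"
| "idx (y # ys) x = (if x = y then length ys else idx ys x)"

text \<open>The environment reached after a block of abstractions over \<open>xs\<close> has
  consumed \<open>map g xs\<close>. The head is consumed first and so ends up outermost, as in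
  \<open>idx\<close>.\<close>

primrec bind :: "'a list \<Rightarrow> ('a \<Rightarrow> tm) \<Rightarrow> (nat \<Rightarrow> tm) \<Rightarrow> nat \<Rightarrow> tm" where
  "bind [] g \<sigma> = \<sigma>"
| "bind (x # xs) g \<sigma> = bind xs g (case_nat (g x) \<sigma>)"

lemma bind_skip [simp]: "bind xs g \<sigma> (length xs + i) = \<sigma> i"
proof (induction xs arbitrary: \<sigma> i)
  case (Cons x xs)
  show ?case using Cons.IH[of _ "Suc i"] by simp
qed simp

lemma bind_idx [simp]: "x \<in> set xs \<Longrightarrow> bind xs g \<sigma> (idx xs x) = g x"
proof (induction xs arbitrary: \<sigma>)
  case (Cons y ys)
  show ?case
  proof (cases "x = y")
    case True
    then show ?thesis using bind_skip[of ys g "case_nat (g y) \<sigma>" 0] by simp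
  next
    case False
    with Cons show ?thesis by simp
  qed
qed simp

text \<open>Iterates \<open>beta_psubst\<close> over the names. This is the beta step for a whole
  block of arguments, by which continuations, registers and tree constructors are all
  passed.\<close>

lemma apps_Lams: "apps (psubst \<sigma> ((Lam ^^ length xs) t)) (map g xs) =\<^sub>\<beta> psubst (bind xs g \<sigma>) t"
proof (induction xs arbitrary: \<sigma>)
  case Nil
  show ?case by (simp add: beta_eq.refl)
next
  case (Cons x xs)
  have "apps (psubst \<sigma> (Lam ((Lam ^^ length xs) t)) \<cdot> g x) (map g xs)
      =\<^sub>\<beta> apps (psubst (case_nat (g x) \<sigma>) ((Lam ^^ length xs) t)) (map g xs)"
    by (intro apps_cong beta_psubst)
  also note Cons.IH
  finally show ?case by simp
qed

section \<open>Typing of blocks of variables, arguments and abstractions\<close>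

lemma typing_Var_Suc: "\<Delta> \<turnstile> Var i \<Ztypecolon> A \<Longrightarrow> B # \<Delta> \<turnstile> Var (Suc i) \<Ztypecolon> A"
  using typing.Var[of "Suc i" "B # \<Delta>"] by (auto elim: typing.cases)

lemma typing_Var_0: "A # \<Delta> \<turnstile> Var 0 \<Ztypecolon> A"
  using typing.Var[of 0 "A # \<Delta>"] by simp

lemma typing_Var_skip: "\<Delta> \<turnstile> Var i \<Ztypecolon> A \<Longrightarrow> rev (map \<tau> xs) @ \<Delta> \<turnstile> Var (length xs + i) \<Ztypecolon> A"
proof (induction xs arbitrary: \<Delta> i)
  case (Cons x xs)
  show ?case using Cons.IH[OF typing_Var_Suc[OF Cons.prems]] by simp
qed simp

text \<open>Typing counterpart of \<open>bind_idx\<close>. Contexts list the innermost variable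
  first, whence \<open>rev\<close>.\<close>

lemma typing_Var_idx: "x \<in> set xs \<Longrightarrow> rev (map \<tau> xs) @ \<Delta> \<turnstile> Var (idx xs x) \<Ztypecolon> \<tau> x"
proof (induction xs arbitrary: \<Delta>)
  case (Cons y ys)
  show ?case
  proof (cases "x = y")
    case True
    then show ?thesis using typing_Var_skip[OF typing_Var_0, of \<tau> ys "\<tau> y" \<Delta>] by simp
  next
    case False
    with Cons show ?thesis by simp
  qed
qed simp

lemma typing_apps:
  assumes "\<Delta> \<turnstile> t \<Ztypecolon> foldr (\<rightharpoonup>) (map \<tau> xs) B" and "\<And>x. x \<in> set xs \<Longrightarrow> \<Delta> \<turnstile> g x \<Ztypecolon> \<tau> x"
  shows "\<Delta> \<turnstile> apps t (map g xs) \<Ztypecolon> B"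
  using assms by (induction xs arbitrary: t) (auto intro: typing.App)

lemma typing_Lams:
  assumes "rev (map \<tau> xs) @ \<Delta> \<turnstile> t \<Ztypecolon> B"
  shows "\<Delta> \<turnstile> (Lam ^^ length xs) t \<Ztypecolon> foldr (\<rightharpoonup>) (map \<tau> xs) B"
  using assms by (induction xs arbitrary: \<Delta>) (auto intro: typing.Lam)

section \<open>Encoded trees\<close>

definition lab :: "'a list \<Rightarrow> 'a \<Rightarrow> nat" where
  "lab as a = length as - length (takeWhile (\<lambda>b. b \<noteq> a) as)"

lemma lab_le: "lab as a \<le> length as"
  by (simp add: lab_def)

text \<open>The leaf variable of the encoding is bound inside the node constructors and shifts their
  indices by one.\<close>

lemma lab_eq_Suc_idx: "a \<in> set as \<Longrightarrow> lab as a = Suc (idx as a)"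
proof (induction as)
  case (Cons b as)
  then show ?case by (cases "a = b") (auto simp: lab_def)
qed simp

lemma enc_body_Node: "enc_body as (Node T a U) = Var (lab as a) \<cdot> enc_body as T \<cdot> enc_body as U"
  by (simp add: lab_def)

declare enc_body.simps(2) [simp del] enc_body_Node [simp]

text \<open>Holds because encodings are closed. It lets the input tree pass unchanged under the
  binders of the output.\<close>

lemma lift_enc: "lift k (enc as T) = enc as T"
proof -
  have "lift k ((Lam ^^ n) t) = (Lam ^^ n) (lift (n + k) t)" for n k t
    by (induction n arbitrary: k) auto
  moreover have "lift (Suc (length as + k)) (enc_body as T) = enc_body as T"
    by (induction T) (use lab_le[of as] in \<open>auto simp: less_Suc_eq_le intro: trans_le_add1\<close>)
  ultimately show ?thesis by (simp add: enc_def)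
qed

lemma ty_subst_BT:
  "ty_subst (BT as) A = foldr (\<rightharpoonup>) (map (\<lambda>_. A \<rightharpoonup> A \<rightharpoonup> A) as) (A \<rightharpoonup> A)"
  by (induction as) (auto simp: BT_def)

lemma BT_foldr: "BT bs = foldr (\<rightharpoonup>) (map (\<lambda>_. Base \<rightharpoonup> Base \<rightharpoonup> Base) bs) (Base \<rightharpoonup> Base)"
  by (induction bs) (auto simp: BT_def)

section \<open>Expressions as terms\<close>

text \<open>The environment \<open>\<sigma>\<close> provides the tree constructors: \<open>\<sigma> 0\<close> is the leaf and
  \<open>\<sigma> (lab bs a)\<close> the node labelled \<open>a\<close>, as in the body of \<open>enc bs\<close>. One-hole expressions are
  translated together with the content of the hole, which avoids binders.\<close>

primrec tm_expr :: "'a list \<Rightarrow> (nat \<Rightarrow> tm) \<Rightarrow> ('v \<Rightarrow> tm) \<Rightarrow> ('w \<Rightarrow> tm) \<Rightarrow> ('a, 'v, 'w) expr \<Rightarrow> tm"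
  and tm_oexpr ::
    "'a list \<Rightarrow> (nat \<Rightarrow> tm) \<Rightarrow> ('v \<Rightarrow> tm) \<Rightarrow> ('w \<Rightarrow> tm) \<Rightarrow> ('a, 'v, 'w) oexpr \<Rightarrow> tm \<Rightarrow> tm" where
  "tm_expr bs \<sigma> i j ELeaf = \<sigma> 0"
| "tm_expr bs \<sigma> i j (EVar x) = i x"
| "tm_expr bs \<sigma> i j (ENode a E F) = \<sigma> (lab bs a) \<cdot> tm_expr bs \<sigma> i j E \<cdot> tm_expr bs \<sigma> i j F"
| "tm_expr bs \<sigma> i j (EPlug E' E) = tm_oexpr bs \<sigma> i j E' (tm_expr bs \<sigma> i j E)"
| "tm_oexpr bs \<sigma> i j OHole = (\<lambda>u. u)"
| "tm_oexpr bs \<sigma> i j (OVar x') = (\<lambda>u. j x' \<cdot> u)"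
| "tm_oexpr bs \<sigma> i j (OENodeL a E' E) =
    (\<lambda>u. \<sigma> (lab bs a) \<cdot> tm_oexpr bs \<sigma> i j E' u \<cdot> tm_expr bs \<sigma> i j E)"
| "tm_oexpr bs \<sigma> i j (OENodeR a E E') =
    (\<lambda>u. \<sigma> (lab bs a) \<cdot> tm_expr bs \<sigma> i j E \<cdot> tm_oexpr bs \<sigma> i j E' u)"
| "tm_oexpr bs \<sigma> i j (OPlug E' F') = (\<lambda>u. tm_oexpr bs \<sigma> i j E' (tm_oexpr bs \<sigma> i j F' u))"

text \<open>As the translation creates no binder, substitution only acts on the three environments
  and the content of the hole.\<close>

lemma
  fixes E :: "('a, 'v, 'w) expr" and E' :: "('a, 'v, 'w) oexpr"
  shows psubst_tm_expr: "psubst \<tau> (tm_expr bs \<sigma> i j E)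
      = tm_expr bs (psubst \<tau> \<circ> \<sigma>) (psubst \<tau> \<circ> i) (psubst \<tau> \<circ> j) E"
    and psubst_tm_oexpr: "psubst \<tau> (tm_oexpr bs \<sigma> i j E' u)
      = tm_oexpr bs (psubst \<tau> \<circ> \<sigma>) (psubst \<tau> \<circ> i) (psubst \<tau> \<circ> j) E' (psubst \<tau> u)"
  by (induction E and E' arbitrary: and u) (auto simp: comp_def)

section \<open>Representation of trees and one-hole trees by open terms\<close>

definition tree_val :: "'a list \<Rightarrow> tm \<Rightarrow> 'a tree \<Rightarrow> bool" where
  "tree_val bs t T \<longleftrightarrow> t =\<^sub>\<beta> enc_body bs T"

text \<open>An extensional condition, as for a logical relation at type
  \<open>o \<rightharpoonup> o\<close>: only the effect on represented trees counts, so no normal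
  form is imposed on the function.\<close>

definition otree_val :: "'a list \<Rightarrow> tm \<Rightarrow> 'a otree \<Rightarrow> bool" where
  "otree_val bs t T' \<longleftrightarrow> (\<forall>u U. tree_val bs u U \<longrightarrow> tree_val bs (t \<cdot> u) (plug T' U))"

lemma plug_oplug: "plug (oplug T' U') U = plug T' (plug U' U)"
  by (induction T') auto

lemma tree_val_Node:
  "tree_val bs t T \<Longrightarrow> tree_val bs u U \<Longrightarrow> tree_val bs (Var (lab bs a) \<cdot> t \<cdot> u) (Node T a U)"
  by (auto simp: tree_val_def intro: beta_eq.app beta_eq.refl)

text \<open>Fundamental lemma of the representation. For \<open>EPlug\<close> the induction
  hypothesis on the one-hole part is applied to the translated content, so the hole content must be
  arbitrary; \<open>OPlug\<close> becomes composition by \<open>plug_oplug\<close>.\<close>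

lemma
  fixes E :: "('a, 'v, 'w) expr" and E' :: "('a, 'v, 'w) oexpr"
  assumes \<sigma>: "\<And>k. k \<le> length bs \<Longrightarrow> \<sigma> k = Var k"
  shows tree_val_tm_expr: "\<lbrakk>\<And>x. x \<in> expr_vars E \<Longrightarrow> tree_val bs (i x) (\<rho> x);
      \<And>x. x \<in> expr_ovars E \<Longrightarrow> otree_val bs (j x) (\<rho>' x)\<rbrakk>
      \<Longrightarrow> tree_val bs (tm_expr bs \<sigma> i j E) (eval_expr \<rho> \<rho>' E)"
    and tree_val_tm_oexpr: "\<lbrakk>\<And>x. x \<in> oexpr_vars E' \<Longrightarrow> tree_val bs (i x) (\<rho> x);
      \<And>x. x \<in> oexpr_ovars E' \<Longrightarrow> otree_val bs (j x) (\<rho>' x); tree_val bs u U\<rbrakk>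
      \<Longrightarrow> tree_val bs (tm_oexpr bs \<sigma> i j E' u) (plug (eval_oexpr \<rho> \<rho>' E') U)"
proof (induction E and E' arbitrary: and u U)
  case ELeaf
  show ?case using \<sigma>[of 0] by (simp add: tree_val_def beta_eq.refl)
next
  case (OVar x)
  then show ?case by (simp add: otree_val_def)
qed (auto simp: \<sigma> lab_le plug_oplug intro!: tree_val_Node)

lemma
  fixes E :: "('a, 'v, 'w) expr" and E' :: "('a, 'v, 'w) oexpr"
  assumes "\<Delta> \<turnstile> \<sigma> 0 \<Ztypecolon> Base"
    and lab: "\<And>a. a \<in> set bs \<Longrightarrow> \<Delta> \<turnstile> \<sigma> (lab bs a) \<Ztypecolon> Base \<rightharpoonup> Base \<rightharpoonup> Base"
    and i: "\<And>x. x \<in> V \<Longrightarrow> \<Delta> \<turnstile> i x \<Ztypecolon> Base"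
    and j: "\<And>x. x \<in> V' \<Longrightarrow> \<Delta> \<turnstile> j x \<Ztypecolon> Base \<rightharpoonup> Base"
  shows typing_tm_expr: "E \<in> ExprBT (set bs) V V' \<Longrightarrow> \<Delta> \<turnstile> tm_expr bs \<sigma> i j E \<Ztypecolon> Base"
    and typing_tm_oexpr: "\<lbrakk>E' \<in> ExprOBT (set bs) V V'; \<Delta> \<turnstile> u \<Ztypecolon> Base\<rbrakk>
      \<Longrightarrow> \<Delta> \<turnstile> tm_oexpr bs \<sigma> i j E' u \<Ztypecolon> Base"
proof (induction E and E' arbitrary: and u)
  case (OVar x)
  then show ?case by (auto simp: ExprOBT_def intro: typing.App[OF j])
next
  case (ENode a E F)
  then show ?case by (auto simp: ExprBT_def intro!: typing.App[OF typing.App[OF lab]])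
next
  case (OENodeL a E' E)
  then show ?case
    by (auto simp: ExprBT_def ExprOBT_def intro!: typing.App[OF typing.App[OF lab]])
next
  case (OENodeR a E E')
  then show ?case
    by (auto simp: ExprBT_def ExprOBT_def intro!: typing.App[OF typing.App[OF lab]])
qed (auto simp: assms ExprBT_def ExprOBT_def)

section \<open>The simulating term\<close>

text \<open>Listing states and registers fixes the order of the curried arguments. Both kinds of
  registers share the list \<open>gs\<close>; as they are disjoint, \<open>reg_ty\<close> can tell
  them apart.\<close>

locale listed_rtt =
  fixes M :: "('q, 'g, 's, 'r) rtt" and as :: "'g list" and bs :: "'s list"
    and qs :: "'q list" and gs :: "'r list"
  assumes rtt: "rtt (set as) (set bs) M"
    and qs: "set qs = states M"
    and gs: "set gs = regs M \<union> oregs M"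
begin

lemma init_in: "init M \<in> set qs"
  using rtt by (simp add: rtt_def qs)

lemma oregs_not_regs: "r \<in> oregs M \<Longrightarrow> r \<notin> regs M"
  using rtt by (auto simp: rtt_def)

lemma out_in: "q \<in> set qs \<Longrightarrow> out M q \<in> ExprBT (set bs) (regs M) (oregs M)"
  using rtt by (simp add: rtt_def qs)

lemma delta_in:
  assumes "delta M (q\<^sub>1, q\<^sub>2, a) = (q, \<psi>, \<psi>')" "q\<^sub>1 \<in> set qs" "q\<^sub>2 \<in> set qs" "a \<in> set as"
  shows "q \<in> set qs"
    and "r \<in> regs M \<Longrightarrow> \<psi> r \<in> ExprBT (set bs) (regs M \<times> UNIV) (oregs M \<times> UNIV)"
    and "r \<in> oregs M \<Longrightarrow> \<psi>' r \<in> ExprOBT (set bs) (regs M \<times> UNIV) (oregs M \<times> UNIV)"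
  using rtt assms unfolding rtt_def qs by blast+

definition reg_ty :: "'r \<Rightarrow> ty" where
  "reg_ty r = (if r \<in> regs M then Base else Base \<rightharpoonup> Base)"

definition cont_ty :: ty where
  "cont_ty = foldr (\<rightharpoonup>) (map reg_ty gs) Base"

definition config_ty :: ty where
  "config_ty = foldr (\<rightharpoonup>) (map (\<lambda>_. cont_ty) qs) Base"

text \<open>Offset \<open>0\<close> past the continuations is the leaf constructor, and the identity
  stands for \<open>Hole\<close>. The summand \<open>0\<close> keeps the shape expected by
  \<open>bind_skip\<close> and \<open>typing_Var_skip\<close>.\<close>

definition init_tm :: tm where
  "init_tm = (Lam ^^ length qs) (apps (Var (idx qs (init M)))
    (map (\<lambda>r. if r \<in> regs M then Var (length qs + 0) else Lam (Var 0)) gs))"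

text \<open>The scope of a transition consists, from the inside out, of the registers of the right
  child, those of the left child, the continuations, the right and the left child, and the
  tree constructors.\<close>

definition child_reg :: "'r \<times> side \<Rightarrow> nat" where
  "child_reg = join (\<lambda>r. length gs + idx gs r) (\<lambda>r. idx gs r)"

definition outer :: "nat \<Rightarrow> nat" where
  "outer i = length gs + (length gs + (length qs + Suc (Suc i)))"

text \<open>A one-hole register is abstracted over the content of its hole; this extra binder
  accounts for each \<open>Suc\<close> and for the final \<open>Var 0\<close>.\<close>

definition next_reg :: "'q \<Rightarrow> 'q \<Rightarrow> 'g \<Rightarrow> 'r \<Rightarrow> tm" where
  "next_reg q\<^sub>1 q\<^sub>2 a r = (case delta M (q\<^sub>1, q\<^sub>2, a) of (q, \<psi>, \<psi>') \<Rightarrow>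
    if r \<in> regs M then
      tm_expr bs (\<lambda>i. Var (outer i)) (\<lambda>x. Var (child_reg x)) (\<lambda>x. Var (child_reg x)) (\<psi> r)
    else
      Lam (tm_oexpr bs (\<lambda>i. Var (Suc (outer i))) (\<lambda>x. Var (Suc (child_reg x)))
        (\<lambda>x. Var (Suc (child_reg x))) (\<psi>' r) (Var 0)))"

definition next_tm :: "'q \<Rightarrow> 'q \<Rightarrow> 'g \<Rightarrow> tm" where
  "next_tm q\<^sub>1 q\<^sub>2 a =
    apps (Var (length gs + (length gs + idx qs (fst (delta M (q\<^sub>1, q\<^sub>2, a))))))
      (map (next_reg q\<^sub>1 q\<^sub>2 a) gs)"

text \<open>Past the continuations, offset \<open>Suc 0\<close> is the left child and
  \<open>0\<close> the right child, which is abstracted last. The right child is called inside each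
  continuation of the left one, where the registers of the left child are in scope.\<close>

definition delta_tm :: "'g \<Rightarrow> tm" where
  "delta_tm a = Lam (Lam ((Lam ^^ length qs)
    (apps (Var (length qs + Suc 0)) (map (\<lambda>q\<^sub>1. (Lam ^^ length gs)
      (apps (Var (length gs + (length qs + 0))) (map (\<lambda>q\<^sub>2. (Lam ^^ length gs)
        (next_tm q\<^sub>1 q\<^sub>2 a)) qs))) qs))))"

definition out_tm :: "'q \<Rightarrow> tm" where
  "out_tm q = (Lam ^^ length gs) (tm_expr bs (\<lambda>i. Var (length gs + i))
    (\<lambda>r. Var (idx gs r)) (\<lambda>r. Var (idx gs r)) (out M q))"

text \<open>The input tree sits just outside the leaf and the \<open>length bs\<close> node
  constructors of the output. It folds \<open>delta_tm\<close> and \<open>init_tm\<close> into a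
  configuration, which then receives the output function as its continuations.\<close>

definition main_body :: tm where
  "main_body =
    apps (apps (Var (Suc (length bs))) (map delta_tm as) \<cdot> init_tm) (map out_tm qs)"

definition main_tm :: tm where
  "main_tm = Lam ((Lam ^^ length bs) (Lam main_body))"

subsection \<open>Typing\<close>

definition tree_ctxt :: "ty list \<Rightarrow> bool" where
  "tree_ctxt \<Delta> \<longleftrightarrow> \<Delta> \<turnstile> Var 0 \<Ztypecolon> Base \<and>
    (\<forall>a\<in>set bs. \<Delta> \<turnstile> Var (lab bs a) \<Ztypecolon> Base \<rightharpoonup> Base \<rightharpoonup> Base)"

lemma typing_init_tm:
  assumes "tree_ctxt \<Delta>"
  shows "\<Delta> \<turnstile> init_tm \<Ztypecolon> config_ty"
  unfolding init_tm_def config_ty_def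
proof (rule typing_Lams, rule typing_apps)
  show "rev (map (\<lambda>_. cont_ty) qs) @ \<Delta> \<turnstile> Var (idx qs (init M)) \<Ztypecolon> foldr (\<rightharpoonup>) (map reg_ty gs) Base"
    unfolding cont_ty_def using typing_Var_idx[OF init_in] .
  fix r
  have "rev (map (\<lambda>_. cont_ty) qs) @ \<Delta> \<turnstile> Var (length qs + 0) \<Ztypecolon> Base"
    using assms by (intro typing_Var_skip) (simp add: tree_ctxt_def)
  then show "rev (map (\<lambda>_. cont_ty) qs) @ \<Delta>
      \<turnstile> (if r \<in> regs M then Var (length qs + 0) else Lam (Var 0)) \<Ztypecolon> reg_ty r"
    by (auto simp: reg_ty_def intro: typing.Lam typing_Var_0)
qed

lemma typing_out_tm:
  assumes "tree_ctxt \<Delta>" and "q \<in> set qs"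
  shows "\<Delta> \<turnstile> out_tm q \<Ztypecolon> cont_ty"
  unfolding out_tm_def cont_ty_def
proof (rule typing_Lams, rule typing_tm_expr[OF _ _ _ _ out_in[OF assms(2)]])
  show "rev (map reg_ty gs) @ \<Delta> \<turnstile> Var (length gs + 0) \<Ztypecolon> Base"
    using assms(1) by (intro typing_Var_skip) (simp add: tree_ctxt_def)
  show "rev (map reg_ty gs) @ \<Delta> \<turnstile> Var (length gs + lab bs a) \<Ztypecolon> Base \<rightharpoonup> Base \<rightharpoonup> Base"
    if "a \<in> set bs" for a
    using assms(1) that by (intro typing_Var_skip) (simp add: tree_ctxt_def)
  show "rev (map reg_ty gs) @ \<Delta> \<turnstile> Var (idx gs r) \<Ztypecolon> Base" if "r \<in> regs M" for r
    using typing_Var_idx[of r gs reg_ty \<Delta>] that by (simp add: gs reg_ty_def)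
  show "rev (map reg_ty gs) @ \<Delta> \<turnstile> Var (idx gs r) \<Ztypecolon> Base \<rightharpoonup> Base" if "r \<in> oregs M" for r
    using typing_Var_idx[of r gs reg_ty \<Delta>] that by (simp add: gs reg_ty_def oregs_not_regs)
qed

lemma typing_next_tm:
  assumes \<Delta>: "tree_ctxt \<Delta>" and q: "q\<^sub>1 \<in> set qs" "q\<^sub>2 \<in> set qs" and a: "a \<in> set as"
  shows "rev (map reg_ty gs) @ rev (map reg_ty gs) @ rev (map (\<lambda>_. cont_ty) qs) @ A # B # \<Delta>
    \<turnstile> next_tm q\<^sub>1 q\<^sub>2 a \<Ztypecolon> Base" (is "?\<Delta> \<turnstile> _ \<Ztypecolon> _")
proof -
  obtain p \<psi> \<psi>' where d: "delta M (q\<^sub>1, q\<^sub>2, a) = (p, \<psi>, \<psi>')"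
    by (cases "delta M (q\<^sub>1, q\<^sub>2, a)") auto
  note d_in = delta_in[OF d q a]
  have outer: "?\<Delta> \<turnstile> Var (outer i) \<Ztypecolon> C" if "\<Delta> \<turnstile> Var i \<Ztypecolon> C" for i C
    unfolding outer_def using that by (intro typing_Var_skip typing_Var_Suc)
  have leaf: "?\<Delta> \<turnstile> Var (outer 0) \<Ztypecolon> Base"
    using \<Delta> by (intro outer) (simp add: tree_ctxt_def)
  have node: "?\<Delta> \<turnstile> Var (outer (lab bs b)) \<Ztypecolon> Base \<rightharpoonup> Base \<rightharpoonup> Base" if "b \<in> set bs" for b
    using \<Delta> that by (intro outer) (simp add: tree_ctxt_def)
  have reg: "?\<Delta> \<turnstile> Var (child_reg x) \<Ztypecolon> reg_ty (fst x)" if "fst x \<in> set gs" for x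
    using that
    by (cases x; cases "snd x")
      (auto simp: child_reg_def join_def intro!: typing_Var_skip typing_Var_idx)
  have vars: "?\<Delta> \<turnstile> Var (child_reg x) \<Ztypecolon> Base" if "x \<in> regs M \<times> UNIV" for x
    using reg[of x] that by (auto simp: gs reg_ty_def)
  have ovars: "?\<Delta> \<turnstile> Var (child_reg x) \<Ztypecolon> Base \<rightharpoonup> Base" if "x \<in> oregs M \<times> UNIV" for x
    using reg[of x] that by (auto simp: gs reg_ty_def oregs_not_regs)
  have "?\<Delta> \<turnstile> next_reg q\<^sub>1 q\<^sub>2 a r \<Ztypecolon> reg_ty r" if "r \<in> set gs" for r
  proof (cases "r \<in> regs M")
    case True
    then show ?thesis
      by (auto simp: next_reg_def d reg_ty_def
          intro!: typing_tm_expr[where V = "regs M \<times> UNIV" and V' = "oregs M \<times> UNIV"]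
          leaf node vars ovars d_in(2))
  next
    case False
    with that have "r \<in> oregs M" by (simp add: gs)
    then have "\<psi>' r \<in> ExprOBT (set bs) (regs M \<times> UNIV) (oregs M \<times> UNIV)" by (rule d_in(3))
    with False show ?thesis
      by (auto simp: next_reg_def d reg_ty_def
          intro!: typing.Lam typing_tm_oexpr[where V = "regs M \<times> UNIV" and V' = "oregs M \<times> UNIV"]
          typing_Var_Suc typing_Var_0 leaf node vars ovars)
  qed
  moreover have "?\<Delta> \<turnstile> Var (length gs + (length gs + idx qs p)) \<Ztypecolon> foldr (\<rightharpoonup>) (map reg_ty gs) Base"
    unfolding cont_ty_def using d_in(1) by (intro typing_Var_skip typing_Var_idx)
  ultimately show ?thesis
    unfolding next_tm_def d fst_conv by (intro typing_apps)
qed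

lemma typing_delta_tm:
  assumes "tree_ctxt \<Delta>" and "a \<in> set as"
  shows "\<Delta> \<turnstile> delta_tm a \<Ztypecolon> config_ty \<rightharpoonup> config_ty \<rightharpoonup> config_ty"
proof -
  let ?\<Delta> = "rev (map (\<lambda>_. cont_ty) qs) @ config_ty # config_ty # \<Delta>"
  have var: "?\<Delta> \<turnstile> Var (length qs + 0) \<Ztypecolon> foldr (\<rightharpoonup>) (map (\<lambda>_. cont_ty) qs) Base"
    "?\<Delta> \<turnstile> Var (length qs + Suc 0) \<Ztypecolon> foldr (\<rightharpoonup>) (map (\<lambda>_. cont_ty) qs) Base"
    unfolding config_ty_def[symmetric] by (intro typing_Var_skip typing_Var_Suc typing_Var_0)+
  have "rev (map reg_ty gs) @ ?\<Delta> \<turnstile> (Lam ^^ length gs) (next_tm q\<^sub>1 q\<^sub>2 a) \<Ztypecolon> cont_ty"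
    if "q\<^sub>1 \<in> set qs" "q\<^sub>2 \<in> set qs" for q\<^sub>1 q\<^sub>2
    unfolding cont_ty_def
    by (rule typing_Lams) (rule typing_next_tm[unfolded cont_ty_def, OF assms(1) that assms(2)])
  then have "?\<Delta> \<turnstile> (Lam ^^ length gs) (apps (Var (length gs + (length qs + 0)))
      (map (\<lambda>q\<^sub>2. (Lam ^^ length gs) (next_tm q\<^sub>1 q\<^sub>2 a)) qs)) \<Ztypecolon> cont_ty" if "q\<^sub>1 \<in> set qs" for q\<^sub>1
    using that typing_Var_skip[OF var(1), of reg_ty gs] unfolding cont_ty_def
    by (intro typing_Lams typing_apps) auto
  then have "config_ty # config_ty # \<Delta> \<turnstile> (Lam ^^ length qs)
    (apps (Var (length qs + Suc 0)) (map (\<lambda>q\<^sub>1. (Lam ^^ length gs)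
      (apps (Var (length gs + (length qs + 0))) (map (\<lambda>q\<^sub>2. (Lam ^^ length gs)
        (next_tm q\<^sub>1 q\<^sub>2 a)) qs))) qs)) \<Ztypecolon> foldr (\<rightharpoonup>) (map (\<lambda>_. cont_ty) qs) Base"
    using var(2) by (intro typing_Lams typing_apps)
  then show ?thesis
    unfolding delta_tm_def by (intro typing.Lam) (simp add: config_ty_def)
qed

text \<open>The input is used as an iterator with result type \<open>config_ty\<close>, which is
  therefore the type substituted for \<open>o\<close>.\<close>

lemma typing_main_tm: "[] \<turnstile> main_tm \<Ztypecolon> ty_subst (BT as) config_ty \<rightharpoonup> BT bs"
proof -
  let ?N = "\<lambda>_ :: 's. Base \<rightharpoonup> Base \<rightharpoonup> Base"
  let ?\<Delta> = "Base # rev (map ?N bs) @ [ty_subst (BT as) config_ty]"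
  have ctxt: "tree_ctxt ?\<Delta>"
    using typing_Var_idx[of _ bs ?N "[ty_subst (BT as) config_ty]"]
    by (auto simp: tree_ctxt_def lab_eq_Suc_idx intro: typing_Var_0 typing_Var_Suc)
  have "?\<Delta> \<turnstile> Var (Suc (length bs + 0)) \<Ztypecolon> ty_subst (BT as) config_ty"
    by (intro typing_Var_Suc typing_Var_skip typing_Var_0)
  then have "?\<Delta> \<turnstile> apps (Var (Suc (length bs))) (map delta_tm as) \<Ztypecolon> config_ty \<rightharpoonup> config_ty"
    by (intro typing_apps[where \<tau> = "\<lambda>_. config_ty \<rightharpoonup> config_ty \<rightharpoonup> config_ty"] typing_delta_tm ctxt)
      (simp_all add: ty_subst_BT)
  then have "?\<Delta> \<turnstile> apps (Var (Suc (length bs))) (map delta_tm as) \<cdot> init_tm \<Ztypecolon> config_ty"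
    by (rule typing.App) (rule typing_init_tm[OF ctxt])
  then have "?\<Delta> \<turnstile> main_body \<Ztypecolon> Base"
    unfolding main_body_def config_ty_def
    by (rule typing_apps) (rule typing_out_tm[OF ctxt[unfolded config_ty_def]])
  then show ?thesis
    unfolding main_tm_def BT_foldr by (intro typing.Lam typing_Lams)
qed

subsection \<open>Correctness\<close>

definition regs_val :: "('r \<Rightarrow> tm) \<Rightarrow> ('r \<Rightarrow> 's tree) \<Rightarrow> ('r \<Rightarrow> 's otree) \<Rightarrow> bool" where
  "regs_val g \<rho> \<rho>' \<longleftrightarrow> (\<forall>r\<in>regs M. tree_val bs (g r) (\<rho> r)) \<and> (\<forall>r\<in>oregs M. otree_val bs (g r) (\<rho>' r))"

text \<open>The contents \<open>g\<close> may depend on \<open>k\<close>: formally they are obtained by substitution from an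
  environment that contains the continuations.\<close>

definition config_val :: "tm \<Rightarrow> 'q \<times> ('r \<Rightarrow> 's tree) \<times> ('r \<Rightarrow> 's otree) \<Rightarrow> bool" where
  "config_val c = (\<lambda>(q, \<rho>, \<rho>'). q \<in> set qs \<and>
    (\<forall>k. \<exists>g. regs_val g \<rho> \<rho>' \<and> apps c (map k qs) =\<^sub>\<beta> apps (k q) (map g gs)))"

lemma config_valE:
  assumes "config_val c (q, \<rho>, \<rho>')"
  obtains g where "regs_val g \<rho> \<rho>'" "apps c (map k qs) =\<^sub>\<beta> apps (k q) (map g gs)"
  using assms by (auto simp: config_val_def)

lemma config_val_init_tm:
  assumes "\<sigma> 0 = Var 0"
  shows "config_val (psubst \<sigma> init_tm) (init M, \<lambda>_. Leaf, \<lambda>_. Hole)"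
proof -
  define g where "g r = (if r \<in> regs M then Var 0 else Lam (Var 0))" for r
  have "Lam (Var 0) \<cdot> u =\<^sub>\<beta> u" for u
    using beta_eq.beta[of "Var 0" u] by simp
  then have "regs_val g (\<lambda>_. Leaf) (\<lambda>_. Hole)"
    by (auto simp: regs_val_def g_def oregs_not_regs tree_val_def otree_val_def
        intro: beta_eq.refl beta_eq.trans)
  moreover have "apps (psubst \<sigma> init_tm) (map k qs) =\<^sub>\<beta> apps (k (init M)) (map g gs)" for k
  proof -
    have "apps (psubst \<sigma> init_tm) (map k qs) =\<^sub>\<beta> psubst (bind qs k \<sigma>) (apps (Var (idx qs (init M)))
        (map (\<lambda>r. if r \<in> regs M then Var (length qs + 0) else Lam (Var 0)) gs))"
      unfolding init_tm_def by (rule apps_Lams)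
    also have "\<dots> = apps (k (init M)) (map g gs)"
      unfolding psubst_apps map_map
      by (intro arg_cong2[where f = apps] map_cong)
        (use assms init_in bind_skip[of qs k \<sigma> 0] in \<open>auto simp: g_def\<close>)
    finally show ?thesis .
  qed
  ultimately show ?thesis
    using init_in by (auto simp: config_val_def)
qed

text \<open>In \<open>\<tau>\<close>, the indices \<open>child_reg\<close> lead to the register
  contents of the children and the indices \<open>outer\<close> lead to \<open>\<sigma>\<close>; the
  fundamental lemma on expressions then applies to each register.\<close>

lemma regs_val_next:
  fixes k :: "'q \<Rightarrow> tm" and c\<^sub>1 c\<^sub>2 :: tm
  assumes d: "delta M (q\<^sub>1, q\<^sub>2, a) = (q, \<psi>, \<psi>')" "q\<^sub>1 \<in> set qs" "q\<^sub>2 \<in> set qs" "a \<in> set as"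
    and \<sigma>: "\<And>i. i \<le> length bs \<Longrightarrow> \<sigma> i = Var i"
    and g: "regs_val g\<^sub>1 \<rho>\<^sub>1 \<rho>\<^sub>1'" "regs_val g\<^sub>2 \<rho>\<^sub>2 \<rho>\<^sub>2'"
  defines "\<tau> \<equiv> bind gs g\<^sub>2 (bind gs g\<^sub>1 (bind qs k (case_nat c\<^sub>2 (case_nat c\<^sub>1 \<sigma>))))"
  shows "regs_val (\<lambda>r. psubst \<tau> (next_reg q\<^sub>1 q\<^sub>2 a r))
    (\<lambda>r. eval_expr (join \<rho>\<^sub>1 \<rho>\<^sub>2) (join \<rho>\<^sub>1' \<rho>\<^sub>2') (\<psi> r))
    (\<lambda>r. eval_oexpr (join \<rho>\<^sub>1 \<rho>\<^sub>2) (join \<rho>\<^sub>1' \<rho>\<^sub>2') (\<psi>' r))"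
proof -
  note d_in = delta_in[OF d]
  have outer: "\<tau> (outer i) = \<sigma> i" for i
    unfolding \<tau>_def outer_def bind_skip by simp
  have reg: "\<tau> (child_reg x) = join g\<^sub>1 g\<^sub>2 x" if "fst x \<in> set gs" for x
    using that by (cases x; cases "snd x") (auto simp: \<tau>_def child_reg_def join_def)
  have vars: "tree_val bs (\<tau> (child_reg x)) (join \<rho>\<^sub>1 \<rho>\<^sub>2 x)" if "x \<in> regs M \<times> UNIV" for x
    using that g by (subst reg) (auto simp: gs regs_val_def join_def split: side.split)
  have ovars: "otree_val bs (\<tau> (child_reg x)) (join \<rho>\<^sub>1' \<rho>\<^sub>2' x)" if "x \<in> oregs M \<times> UNIV" for x
    using that g by (subst reg) (auto simp: gs regs_val_def join_def split: side.split)
  show ?thesis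
    unfolding regs_val_def
  proof (intro conjI ballI)
    fix r assume r: "r \<in> regs M"
    have "tree_val bs (tm_expr bs (psubst \<tau> \<circ> (\<lambda>i. Var (outer i)))
        (psubst \<tau> \<circ> (\<lambda>x. Var (child_reg x))) (psubst \<tau> \<circ> (\<lambda>x. Var (child_reg x))) (\<psi> r))
        (eval_expr (join \<rho>\<^sub>1 \<rho>\<^sub>2) (join \<rho>\<^sub>1' \<rho>\<^sub>2') (\<psi> r))"
      using d_in(2)[OF r]
      by (intro tree_val_tm_expr) (auto simp: outer \<sigma> ExprBT_def intro!: vars ovars)
    then show "tree_val bs (psubst \<tau> (next_reg q\<^sub>1 q\<^sub>2 a r))
        (eval_expr (join \<rho>\<^sub>1 \<rho>\<^sub>2) (join \<rho>\<^sub>1' \<rho>\<^sub>2') (\<psi> r))"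
      using r by (simp add: next_reg_def d psubst_tm_expr)
  next
    fix r assume r: "r \<in> oregs M"
    let ?E = "tm_oexpr bs (\<lambda>i. Var (Suc (outer i))) (\<lambda>x. Var (Suc (child_reg x)))
        (\<lambda>x. Var (Suc (child_reg x))) (\<psi>' r)"
    have "tree_val bs (psubst \<tau> (Lam (?E (Var 0))) \<cdot> u)
        (plug (eval_oexpr (join \<rho>\<^sub>1 \<rho>\<^sub>2) (join \<rho>\<^sub>1' \<rho>\<^sub>2') (\<psi>' r)) U)"
      if "tree_val bs u U" for u U
    proof -
      \<comment> \<open>Filling the hole puts \<open>u\<close> in front of \<open>\<tau>\<close>, so
        the variables shifted by \<open>Suc\<close> are looked up in \<open>\<tau>\<close>
        again.\<close>
      have "psubst \<tau> (Lam (?E (Var 0))) \<cdot> u =\<^sub>\<beta> psubst (case_nat u \<tau>) (?E (Var 0))"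
        by (rule beta_psubst)
      moreover have "tree_val bs (psubst (case_nat u \<tau>) (?E (Var 0)))
          (plug (eval_oexpr (join \<rho>\<^sub>1 \<rho>\<^sub>2) (join \<rho>\<^sub>1' \<rho>\<^sub>2') (\<psi>' r)) U)"
        unfolding psubst_tm_oexpr using d_in(3)[OF r] that
        by (intro tree_val_tm_oexpr) (auto simp: outer \<sigma> ExprOBT_def intro!: vars ovars)
      ultimately show ?thesis
        by (auto simp: tree_val_def intro: beta_eq.trans)
    qed
    then show "otree_val bs (psubst \<tau> (next_reg q\<^sub>1 q\<^sub>2 a r))
        (eval_oexpr (join \<rho>\<^sub>1 \<rho>\<^sub>2) (join \<rho>\<^sub>1' \<rho>\<^sub>2') (\<psi>' r))"
      using oregs_not_regs[OF r] by (simp add: next_reg_def d otree_val_def)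
  qed
qed

text \<open>Each child configuration selects the continuation of its own state, first on the left
  and then on the right, which leaves exactly \<open>next_tm\<close> for the actual pair of
  states.\<close>

lemma config_val_delta_tm:
  assumes \<sigma>: "\<And>i. i \<le> length bs \<Longrightarrow> \<sigma> i = Var i"
    and c\<^sub>1: "config_val c\<^sub>1 (q\<^sub>1, \<rho>\<^sub>1, \<rho>\<^sub>1')" and c\<^sub>2: "config_val c\<^sub>2 (q\<^sub>2, \<rho>\<^sub>2, \<rho>\<^sub>2')"
    and d: "delta M (q\<^sub>1, q\<^sub>2, a) = (q, \<psi>, \<psi>')" and a: "a \<in> set as"
  shows "config_val (psubst \<sigma> (delta_tm a) \<cdot> c\<^sub>1 \<cdot> c\<^sub>2)
    (q, \<lambda>r. eval_expr (join \<rho>\<^sub>1 \<rho>\<^sub>2) (join \<rho>\<^sub>1' \<rho>\<^sub>2') (\<psi> r),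
        \<lambda>r. eval_oexpr (join \<rho>\<^sub>1 \<rho>\<^sub>2) (join \<rho>\<^sub>1' \<rho>\<^sub>2') (\<psi>' r))"
  unfolding config_val_def split_def fst_conv snd_conv
proof (intro conjI allI)
  have q: "q\<^sub>1 \<in> set qs" "q\<^sub>2 \<in> set qs"
    using c\<^sub>1 c\<^sub>2 by (auto simp: config_val_def)
  show "q \<in> set qs" by (rule delta_in(1)[OF d q a])
  fix k
  define \<tau>\<^sub>0 where "\<tau>\<^sub>0 = bind qs k (case_nat c\<^sub>2 (case_nat c\<^sub>1 \<sigma>))"
  define k\<^sub>2 where "k\<^sub>2 = (\<lambda>q\<^sub>1 q\<^sub>2. (Lam ^^ length gs) (next_tm q\<^sub>1 q\<^sub>2 a))"
  define k\<^sub>1 where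
    "k\<^sub>1 = (\<lambda>q. (Lam ^^ length gs) (apps (Var (length gs + (length qs + 0))) (map (k\<^sub>2 q) qs)))"
  define t where "t = (Lam ^^ length qs) (apps (Var (length qs + Suc 0)) (map k\<^sub>1 qs))"
  have delta_tm: "delta_tm a = Lam (Lam t)"
    by (simp add: delta_tm_def t_def k\<^sub>1_def k\<^sub>2_def)
  \<comment> \<open>The arbitrary continuations in \<open>config_val\<close> are instantiated by
    those written in \<open>delta_tm\<close>, closed by the current environment. The contents
    \<open>g\<^sub>1\<close> obtained here enter \<open>\<tau>\<^sub>1\<close>, so
    \<open>g\<^sub>2\<close> can only be chosen afterwards.\<close>
  obtain g\<^sub>1 where g\<^sub>1: "regs_val g\<^sub>1 \<rho>\<^sub>1 \<rho>\<^sub>1'"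
    and c\<^sub>1_eq: "apps c\<^sub>1 (map (psubst \<tau>\<^sub>0 \<circ> k\<^sub>1) qs) =\<^sub>\<beta> apps (psubst \<tau>\<^sub>0 (k\<^sub>1 q\<^sub>1)) (map g\<^sub>1 gs)"
    using config_valE[OF c\<^sub>1, of "psubst \<tau>\<^sub>0 \<circ> k\<^sub>1"] unfolding comp_apply by blast
  define \<tau>\<^sub>1 where "\<tau>\<^sub>1 = bind gs g\<^sub>1 \<tau>\<^sub>0"
  obtain g\<^sub>2 where g\<^sub>2: "regs_val g\<^sub>2 \<rho>\<^sub>2 \<rho>\<^sub>2'"
    and c\<^sub>2_eq: "apps c\<^sub>2 (map (psubst \<tau>\<^sub>1 \<circ> k\<^sub>2 q\<^sub>1) qs) =\<^sub>\<beta> apps (psubst \<tau>\<^sub>1 (k\<^sub>2 q\<^sub>1 q\<^sub>2)) (map g\<^sub>2 gs)"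
    using config_valE[OF c\<^sub>2, of "psubst \<tau>\<^sub>1 \<circ> k\<^sub>2 q\<^sub>1"] unfolding comp_apply by blast
  define \<tau>\<^sub>2 where "\<tau>\<^sub>2 = bind gs g\<^sub>2 \<tau>\<^sub>1"
  have "psubst \<sigma> (delta_tm a) \<cdot> c\<^sub>1 =\<^sub>\<beta> psubst (case_nat c\<^sub>1 \<sigma>) (Lam t)"
    unfolding delta_tm by (rule beta_psubst)
  then have "psubst \<sigma> (delta_tm a) \<cdot> c\<^sub>1 \<cdot> c\<^sub>2 =\<^sub>\<beta> psubst (case_nat c\<^sub>1 \<sigma>) (Lam t) \<cdot> c\<^sub>2"
    by (rule beta_eq.app[OF _ beta_eq.refl])
  also have "\<dots> =\<^sub>\<beta> psubst (case_nat c\<^sub>2 (case_nat c\<^sub>1 \<sigma>)) t"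
    by (rule beta_psubst)
  finally have "apps (psubst \<sigma> (delta_tm a) \<cdot> c\<^sub>1 \<cdot> c\<^sub>2) (map k qs)
      =\<^sub>\<beta> apps (psubst (case_nat c\<^sub>2 (case_nat c\<^sub>1 \<sigma>)) t) (map k qs)"
    by (rule apps_cong)
  also have "\<dots> =\<^sub>\<beta> psubst \<tau>\<^sub>0 (apps (Var (length qs + Suc 0)) (map k\<^sub>1 qs))"
    unfolding t_def \<tau>\<^sub>0_def by (rule apps_Lams)
  also have "\<dots> = apps c\<^sub>1 (map (psubst \<tau>\<^sub>0 \<circ> k\<^sub>1) qs)"
    unfolding psubst_apps psubst.simps \<tau>\<^sub>0_def bind_skip by simp
  also note c\<^sub>1_eq
  also have "apps (psubst \<tau>\<^sub>0 (k\<^sub>1 q\<^sub>1)) (map g\<^sub>1 gs)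
      =\<^sub>\<beta> psubst \<tau>\<^sub>1 (apps (Var (length gs + (length qs + 0))) (map (k\<^sub>2 q\<^sub>1) qs))"
    unfolding k\<^sub>1_def \<tau>\<^sub>1_def by (rule apps_Lams)
  also have "\<dots> = apps c\<^sub>2 (map (psubst \<tau>\<^sub>1 \<circ> k\<^sub>2 q\<^sub>1) qs)"
    unfolding psubst_apps psubst.simps \<tau>\<^sub>1_def \<tau>\<^sub>0_def bind_skip by simp
  also note c\<^sub>2_eq
  also have "apps (psubst \<tau>\<^sub>1 (k\<^sub>2 q\<^sub>1 q\<^sub>2)) (map g\<^sub>2 gs) =\<^sub>\<beta> psubst \<tau>\<^sub>2 (next_tm q\<^sub>1 q\<^sub>2 a)"
    unfolding k\<^sub>2_def \<tau>\<^sub>2_def by (rule apps_Lams)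
  also have "\<dots> = apps (k q) (map (\<lambda>r. psubst \<tau>\<^sub>2 (next_reg q\<^sub>1 q\<^sub>2 a r)) gs)"
    using \<open>q \<in> set qs\<close> by (simp add: next_tm_def d \<tau>\<^sub>2_def \<tau>\<^sub>1_def \<tau>\<^sub>0_def comp_def)
  finally show "\<exists>g. regs_val g (\<lambda>r. eval_expr (join \<rho>\<^sub>1 \<rho>\<^sub>2) (join \<rho>\<^sub>1' \<rho>\<^sub>2') (\<psi> r))
        (\<lambda>r. eval_oexpr (join \<rho>\<^sub>1 \<rho>\<^sub>2) (join \<rho>\<^sub>1' \<rho>\<^sub>2') (\<psi>' r)) \<and>
      apps (psubst \<sigma> (delta_tm a) \<cdot> c\<^sub>1 \<cdot> c\<^sub>2) (map k qs) =\<^sub>\<beta> apps (k q) (map g gs)"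
    using regs_val_next[OF d q a \<sigma> g\<^sub>1 g\<^sub>2, of k c\<^sub>2 c\<^sub>1]
    unfolding \<tau>\<^sub>2_def \<tau>\<^sub>1_def \<tau>\<^sub>0_def by blast
qed

text \<open>Under this environment the body of the encoding is a fold: its leaf variable becomes
  \<open>init_tm\<close> and each label variable the corresponding \<open>delta_tm\<close>, matching
  the bottom-up recursion of \<open>config\<close>.\<close>

lemma config_val_tree:
  assumes \<sigma>: "\<And>i. i \<le> length bs \<Longrightarrow> \<sigma> i = Var i" and "T \<in> BinTree (set as)"
  shows "config_val (psubst (case_nat (psubst \<sigma> init_tm) (bind as (\<lambda>a. psubst \<sigma> (delta_tm a)) Var))
    (enc_body as T)) (config M T)"
  using assms(2)
proof (induction T)
  case Leaf
  then show ?case by (simp add: config_val_init_tm \<sigma>)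
next
  case (Node T a U)
  obtain q\<^sub>1 \<rho>\<^sub>1 \<rho>\<^sub>1' where T: "config M T = (q\<^sub>1, \<rho>\<^sub>1, \<rho>\<^sub>1')" by (cases "config M T") auto
  obtain q\<^sub>2 \<rho>\<^sub>2 \<rho>\<^sub>2' where U: "config M U = (q\<^sub>2, \<rho>\<^sub>2, \<rho>\<^sub>2')" by (cases "config M U") auto
  obtain q \<psi> \<psi>' where d: "delta M (q\<^sub>1, q\<^sub>2, a) = (q, \<psi>, \<psi>')"
    by (cases "delta M (q\<^sub>1, q\<^sub>2, a)") auto
  have a: "a \<in> set as" and sub: "T \<in> BinTree (set as)" "U \<in> BinTree (set as)"
    using Node.prems by (auto simp: BinTree_def)
  show ?case
    using config_val_delta_tm[OF \<sigma> Node.IH(1)[OF sub(1), unfolded T] Node.IH(2)[OF sub(2), unfolded U] d a]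
    by (simp add: T U d Let_def lab_eq_Suc_idx a)
qed

text \<open>The configuration selects the continuation \<open>out_tm q\<close> of its own state and
  passes the register contents to it.\<close>

lemma tree_val_out_tm:
  assumes \<sigma>: "\<And>i. i \<le> length bs \<Longrightarrow> \<sigma> i = Var i"
    and c: "config_val c (config M T)"
  shows "tree_val bs (apps c (map (\<lambda>q. psubst \<sigma> (out_tm q)) qs)) (rtt_output M T)"
proof -
  obtain q \<rho> \<rho>' where T: "config M T = (q, \<rho>, \<rho>')" by (cases "config M T") auto
  with c have q: "q \<in> set qs" by (simp add: config_val_def)
  obtain g where g: "regs_val g \<rho> \<rho>'"
    and "apps c (map (\<lambda>q. psubst \<sigma> (out_tm q)) qs) =\<^sub>\<beta> apps (psubst \<sigma> (out_tm q)) (map g gs)"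
    by (rule config_valE[OF c[unfolded T]])
  note this(2)
  also have "apps (psubst \<sigma> (out_tm q)) (map g gs)
      =\<^sub>\<beta> psubst (bind gs g \<sigma>) (tm_expr bs (\<lambda>i. Var (length gs + i))
        (\<lambda>r. Var (idx gs r)) (\<lambda>r. Var (idx gs r)) (out M q))" (is "_ =\<^sub>\<beta> ?t")
    unfolding out_tm_def by (rule apps_Lams)
  finally have "apps c (map (\<lambda>q. psubst \<sigma> (out_tm q)) qs) =\<^sub>\<beta> ?t" .
  moreover have "tree_val bs ?t (eval_expr \<rho> \<rho>' (out M q))"
    unfolding psubst_tm_expr using g out_in[OF q]
    by (intro tree_val_tm_expr) (auto simp: \<sigma> gs regs_val_def ExprBT_def subset_eq)
  ultimately show ?thesis
    by (auto simp: tree_val_def rtt_output_def T intro: beta_eq.trans)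
qed

lemma main_tm_correct:
  assumes T: "T \<in> BinTree (set as)"
  shows "main_tm \<cdot> enc as T =\<^sub>\<beta> enc bs (rtt_output M T)"
proof -
  \<comment> \<open>The environment below the output binders: indices up to \<open>length bs\<close>
    are the output constructors, the next one is the input tree, and all terms from outside are
    lifted past these \<open>Suc (length bs)\<close> binders.\<close>
  define \<sigma> where "\<sigma> i = (if i \<le> length bs then Var i
    else (lift 0 ^^ Suc (length bs)) (case_nat (enc as T) Var (i - Suc (length bs))))" for i
  have \<sigma>: "\<sigma> i = Var i" if "i \<le> length bs" for i
    using that by (simp add: \<sigma>_def)
  have lifts: "(lift 0 ^^ n) (enc as T) = enc as T" for n
    by (induction n) (auto simp: lift_enc)
  \<comment> \<open>The identity environment brings the encoding into the form required by
    \<open>apps_Lams\<close>.\<close>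
  have \<sigma>_enc: "\<sigma> (Suc (length bs)) = psubst Var ((Lam ^^ length as) (Lam (enc_body as T)))"
    using lifts[of "Suc (length bs)"] by (simp add: \<sigma>_def psubst_Var enc_def)
  define \<tau> where "\<tau> = bind as (\<lambda>a. psubst \<sigma> (delta_tm a)) Var"
  let ?c = "psubst (case_nat (psubst \<sigma> init_tm) \<tau>) (enc_body as T)"
  have "apps (\<sigma> (Suc (length bs))) (map (\<lambda>a. psubst \<sigma> (delta_tm a)) as)
      =\<^sub>\<beta> psubst \<tau> (Lam (enc_body as T))"
    unfolding \<sigma>_enc \<tau>_def by (rule apps_Lams)
  then have "apps (\<sigma> (Suc (length bs))) (map (\<lambda>a. psubst \<sigma> (delta_tm a)) as) \<cdot> psubst \<sigma> init_tm
      =\<^sub>\<beta> psubst \<tau> (Lam (enc_body as T)) \<cdot> psubst \<sigma> init_tm"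
    by (rule beta_eq.app[OF _ beta_eq.refl])
  also have "\<dots> =\<^sub>\<beta> ?c" by (rule beta_psubst)
  finally have "psubst \<sigma> main_body =\<^sub>\<beta> apps ?c (map (\<lambda>q. psubst \<sigma> (out_tm q)) qs)"
    unfolding main_body_def by (simp add: comp_def apps_cong)
  moreover have "tree_val bs (apps ?c (map (\<lambda>q. psubst \<sigma> (out_tm q)) qs)) (rtt_output M T)"
    unfolding \<tau>_def by (intro tree_val_out_tm config_val_tree \<sigma> T)
  ultimately have body: "psubst \<sigma> main_body =\<^sub>\<beta> enc_body bs (rtt_output M T)"
    unfolding tree_val_def by (rule beta_eq.trans)
  have "main_tm = psubst Var (Lam ((Lam ^^ Suc (length bs)) main_body))"
    by (simp add: main_tm_def psubst_Var funpow_swap1)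
  then have "main_tm \<cdot> enc as T =\<^sub>\<beta> psubst (case_nat (enc as T) Var) ((Lam ^^ Suc (length bs)) main_body)"
    by (simp only: beta_psubst)
  also have "\<dots> = (Lam ^^ Suc (length bs)) (psubst \<sigma> main_body)"
    by (rule psubst_Lams) (auto simp: \<sigma>_def)
  also have "\<dots> =\<^sub>\<beta> (Lam ^^ Suc (length bs)) (enc_body bs (rtt_output M T))"
    by (rule beta_eq_Lams[OF body])
  also have "\<dots> = enc bs (rtt_output M T)"
    by (simp add: enc_def funpow_swap1)
  finally show ?thesis .
qed

end

theorem theorem34:
  fixes \<Gamma> :: "'g set" and \<Sigma> :: "'s set"
    and as :: "'g list" and bs :: "'s list"
    and M :: "('q, 'g, 's, 'r) rtt"
    and f :: "'g tree \<Rightarrow> 's tree"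
  assumes "finite \<Gamma>" and "finite \<Sigma>"
    and "distinct as" and "set as = \<Gamma>"
    and "distinct bs" and "set bs = \<Sigma>"
    and "\<forall>T\<in>BinTree \<Gamma>. f T \<in> BinTree \<Sigma>"
    and "rtt \<Gamma> \<Sigma> M"
    and "computes \<Gamma> M f"
  shows "\<exists>A t. [] \<turnstile> t \<Ztypecolon> ty_subst (BT as) A \<rightharpoonup> BT bs \<and>
    (\<forall>T\<in>BinTree \<Gamma>. t \<cdot> enc as T =\<^sub>\<beta> enc bs (f T))"
proof -
  have "finite (states M)" and "finite (regs M \<union> oregs M)"
    using assms(8) by (auto simp: rtt_def)
  \<comment> \<open>Finiteness provides the enumerations; the witnesses for the type and the term
    are then \<open>config_ty\<close> and \<open>main_tm\<close>.\<close>
  then obtain qs gs where "set qs = states M" and "set gs = regs M \<union> oregs M"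
    by (meson finite_list)
  with assms interpret listed_rtt M as bs qs gs
    by unfold_locales auto
  show ?thesis
    using typing_main_tm main_tm_correct assms(4,9) by (auto simp: computes_def)
qed

end
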